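(* For all $m,n\in\mathbb{N}$, the $q$-analog of the Fibonomial number $$\genfrac{[}{]}{0pt}{0}{m+n}{n}_{\mathcal F}=\frac{[F_{m+n}]_q^!}{[F_m]_q^!\,[F_n]_q^!}$$ is a polynomial in $q$ with non-negative integer coefficients, and it can be computed as $$\genfrac{[}{]}{0pt}{0}{m+n}{n}_{\mathcal F}=\sum_{T\in\mathcal{T}_{m,n}}\omega(T),$$ where $\mathcal{T}_{m,n}$ is the set of path-domino tilings of an $m\times n$ rectangle and $\omega(T)$ is the $q$-weight of $T$.
   Context: $\mathbb{N}=\{1,2,3,\dots\}$. The Fibonacci numbers are $F_0=0$, $F_1=1$, $F_n=F_{n-1}+F_{n-2}$. For $n\in\mathbb{N}$, $[n]_q=1+q+\dots+q^{n-1}$, and $[F_n]_q^!=\prod_{k=1}^n[F_k]_q$. The $m\times n$ rectangle has $m$ columns and $n$ rows of unit cells, with lower-left corner $(0,0)$ and upper-right corner $(m,n)$. A monomino is a single unit cell; a domino consists of two adjacent unit cells, horizontal ($2$ wide, $1$ high) or vertical ($1$ wide, $2$ high). A path-domino tiling of the $m\times n$ rectangle consists of a lattice path from $(0,0)$ to $(m,n)$ with unit north steps $(0,1)$ and unit east steps $(1,0)$, together with a tiling of the rectangle by monominos and dominos (each tile lying entirely above or entirely below the path) such that: (1) all tiles above the path are monominos or horizontal dominos; (2) all tiles below the path are monominos or vertical dominos; (3) every tile that touches the path from below (that is, whose top side is an east step of the path) is a vertical domino. The tiles in (3) are called special vertical dominos. (An east step at height $0$ has no tile below it and gives no condition.)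 $\mathcal{T}_{m,n}$ denotes the set of all path-domino tilings of the $m\times n$ rectangle. $q$-weights of tiles: let $(i,j)$ be the coordinates of the top-right corner of the tile. A monomino has weight $1$; a horizontal domino has weight $q^{F_iF_j}$; a non-special vertical domino has weight $q^{F_iF_j}$; a special vertical domino has weight $q^{F_{i+1}F_j}$. The $q$-weight $\omega(T)$ of $T\in\mathcal{T}_{m,n}$ is the product of the weights of all its tiles. *)

theory Defs
  imports
    "HOL-Computational_Algebra.Computational_Algebra"
    "HOL-Number_Theory.Fib"
    "HOL-Library.Disjoint_Sets"
begin

definition q_int :: "nat \<Rightarrow> int poly" where
  "q_int n = (\<Sum>k<n. monom 1 k)"

definition q_fib_fact :: "nat \<Rightarrow> int poly" where
  "q_fib_fact n = (\<Prod>k=1..n. q_int (fib k))"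

(* The quotient is taken in the field of fractions of Z[q]; N - n is meant for n \<le> N. *)
definition q_fibonomial :: "nat \<Rightarrow> nat \<Rightarrow> int poly fract" where
  "q_fibonomial N n =
     to_fract (q_fib_fact N) / (to_fract (q_fib_fact (N - n)) * to_fract (q_fib_fact n))"

datatype step = North | East

(* A lattice path starting at (0,0) is given by its sequence of steps. *)
definition lattice_paths :: "nat \<Rightarrow> nat \<Rightarrow> step list set" where
  "lattice_paths m n = {p. count_list p East = m \<and> count_list p North = n}"

(* An east step from (i - 1, h) to (i, h) is represented by its endpoint (i, h). *)
definition east_steps :: "step list \<Rightarrow> (nat \<times> nat) set" where
  "east_steps p =
     {(count_list (take (Suc k) p) East, count_list (take (Suc k) p) North) |k.
        k < length p \<and> p ! k = East}"

(* Tiles are given by their shape and the coordinates of their top-right corner. *)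
datatype tile = Monomino "nat \<times> nat" | Horizontal "nat \<times> nat" | Vertical "nat \<times> nat"

fun top_right :: "tile \<Rightarrow> nat \<times> nat" where
  "top_right (Monomino c) = c"
| "top_right (Horizontal c) = c"
| "top_right (Vertical c) = c"

(* A unit cell is represented by its top-right corner. A domino that would stick out of the
   first quadrant gets a cell with a zero coordinate, which lies in no rectangle below. *)
fun tile_cells :: "tile \<Rightarrow> (nat \<times> nat) set" where
  "tile_cells (Monomino (i, j)) = {(i, j)}"
| "tile_cells (Horizontal (i, j)) = {(i - 1, j), (i, j)}"
| "tile_cells (Vertical (i, j)) = {(i, j - 1), (i, j)}"

definition rectangle :: "nat \<Rightarrow> nat \<Rightarrow> (nat \<times> nat) set" where
  "rectangle m n = {1..m} \<times> {1..n}"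

definition is_tiling :: "nat \<Rightarrow> nat \<Rightarrow> tile set \<Rightarrow> bool" where
  "is_tiling m n T \<longleftrightarrow>
     disjoint_family_on tile_cells T \<and> (\<Union>t\<in>T. tile_cells t) = rectangle m n"

(* The position of a cell relative to the path is decided in the cell's own column,
   which contains exactly one east step. *)
definition above_path :: "step list \<Rightarrow> tile \<Rightarrow> bool" where
  "above_path p t \<longleftrightarrow> (\<forall>(i, j) \<in> tile_cells t. \<exists>h<j. (i, h) \<in> east_steps p)"

definition below_path :: "step list \<Rightarrow> tile \<Rightarrow> bool" where
  "below_path p t \<longleftrightarrow> (\<forall>(i, j) \<in> tile_cells t. \<exists>h\<ge>j. (i, h) \<in> east_steps p)"

definition touches_from_below :: "step list \<Rightarrow> tile \<Rightarrow> bool" where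
  "touches_from_below p t \<longleftrightarrow> below_path p t \<and> top_right t \<in> east_steps p"

definition path_domino_tilings :: "nat \<Rightarrow> nat \<Rightarrow> (step list \<times> tile set) set" where
  "path_domino_tilings m n =
     {(p, T). p \<in> lattice_paths m n \<and> is_tiling m n T \<and>
        (\<forall>t\<in>T. above_path p t \<or> below_path p t) \<and>
        (\<forall>t\<in>T. above_path p t \<longrightarrow> (\<exists>c. t = Monomino c \<or> t = Horizontal c)) \<and>
        (\<forall>t\<in>T. below_path p t \<longrightarrow> (\<exists>c. t = Monomino c \<or> t = Vertical c)) \<and>
        (\<forall>t\<in>T. touches_from_below p t \<longrightarrow> (\<exists>c. t = Vertical c))}"

fun tile_weight :: "step list \<Rightarrow> tile \<Rightarrow> int poly" where
  "tile_weight p (Monomino (i, j)) = 1"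
| "tile_weight p (Horizontal (i, j)) = monom 1 (fib i * fib j)"
| "tile_weight p (Vertical (i, j)) =
     (if touches_from_below p (Vertical (i, j))
      then monom 1 (fib (i + 1) * fib j) else monom 1 (fib i * fib j))"

definition tiling_weight :: "step list \<times> tile set \<Rightarrow> int poly" where
  "tiling_weight = (\<lambda>(p, T). \<Prod>t\<in>T. tile_weight p t)"

end

(* Expanding a weighted sum of tilings at one cell factorizes it along any cut that no tile of
   nonzero weight crosses. Since the tiles left of the path are horizontal and those below it
   vertical, such cuts isolate the top row if the path ends with a north step, and the rightmost
   column if it ends with an east step. A row or column obeys a Fibonacci recurrence, hence
   contributes a q-integer [F_k] in a power of q, and the tiling sum satisfies the recurrence of
   the q-Fibonomials, which is the q-version of F_(m+n) = F_(m+1) F_n + F_m F_(n-1). *)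
theory Submission
  imports Defs
begin

section \<open>Weighted sums of tilings\<close>

text \<open>Arbitrary cell sets are allowed, not only rectangles, so that the region left after
  removing one tile is again of this kind.\<close>

definition tilings :: "(nat \<times> nat) set \<Rightarrow> tile set set" where
  "tilings A = {T. disjoint_family_on tile_cells T \<and> (\<Union>t\<in>T. tile_cells t) = A}"

text \<open>All three shapes may occur; restrictions on tiles enter through \<open>w\<close>, which
  can be set to 0 on forbidden ones.\<close>

definition tiling_sum :: "(tile \<Rightarrow> 'a::comm_semiring_1) \<Rightarrow> (nat \<times> nat) set \<Rightarrow> 'a" where
  "tiling_sum w A = (\<Sum>T\<in>tilings A. \<Prod>t\<in>T. w t)"

text \<open>In particular no tile is empty, which keeps a tile out of every tiling of a region that
  avoids its cells.\<close>

lemma top_right_in_tile_cells: "top_right t \<in> tile_cells t"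
  by (cases t rule: tile_cells.cases) auto

lemma finite_tiles_subset:
  assumes "finite A"
  shows "finite {t. tile_cells t \<subseteq> A}"
proof (rule finite_subset)
  show "{t. tile_cells t \<subseteq> A} \<subseteq> Monomino ` A \<union> Horizontal ` A \<union> Vertical ` A"
  proof
    fix t assume "t \<in> {t. tile_cells t \<subseteq> A}"
    then have "top_right t \<in> A"
      using top_right_in_tile_cells by blast
    then show "t \<in> Monomino ` A \<union> Horizontal ` A \<union> Vertical ` A"
      by (cases t) auto
  qed
qed (use assms in auto)

lemma tilings_subset: "T \<in> tilings A \<Longrightarrow> T \<subseteq> {t. tile_cells t \<subseteq> A}"
  by (auto simp: tilings_def)

lemma finite_tilings: "finite A \<Longrightarrow> finite (tilings A)"
  by (rule finite_subset[of _ "Pow {t. tile_cells t \<subseteq> A}"])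
     (auto simp: finite_tiles_subset dest: tilings_subset)

lemma finite_tiling: "T \<in> tilings A \<Longrightarrow> finite A \<Longrightarrow> finite T"
  using finite_subset[OF tilings_subset finite_tiles_subset] .

lemma tilings_empty: "tilings {} = {{}}"
  using top_right_in_tile_cells by (fastforce simp: tilings_def disjoint_family_on_def)

lemma tiling_sum_empty [simp]: "tiling_sum w {} = 1"
  by (simp add: tiling_sum_def tilings_empty)

lemma tiling_sum_cong:
  assumes "A = B" and "\<And>t. tile_cells t \<subseteq> A \<Longrightarrow> w t = w' t"
  shows "tiling_sum w A = tiling_sum w' B"
  unfolding tiling_sum_def assms(1)[symmetric]
  by (intro sum.cong prod.cong refl assms(2)) (use tilings_subset in blast)

text \<open>Passes from tilings through a fixed tile to tilings of a smaller region. The inverse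
  removes the tile, which cannot reappear in the smaller region because it is nonempty.\<close>

lemma insert_tilings:
  assumes "tile_cells t \<subseteq> A"
  shows "bij_betw (insert t) (tilings (A - tile_cells t)) {T \<in> tilings A. t \<in> T}"
proof (rule bij_betw_byWitness[where f' = "\<lambda>T. T - {t}"])
  have notin: "t \<notin> T" if "T \<in> tilings (A - tile_cells t)" for T
    using that top_right_in_tile_cells[of t] by (auto simp: tilings_def)
  show "\<forall>T\<in>tilings (A - tile_cells t). insert t T - {t} = T"
    using notin by auto
  show "\<forall>T\<in>{T \<in> tilings A. t \<in> T}. insert t (T - {t}) = T"
    by auto
  show "insert t ` tilings (A - tile_cells t) \<subseteq> {T \<in> tilings A. t \<in> T}"
    using assms by (fastforce simp: tilings_def disjoint_family_on_def)
  show "(\<lambda>T. T - {t}) ` {T \<in> tilings A. t \<in> T} \<subseteq> tilings (A - tile_cells t)"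
    by (fastforce simp: tilings_def disjoint_family_on_def)
qed

text \<open>Tilings are classified by the tile covering \<open>c\<close>: one exists since
  \<open>c\<close> lies in \<open>A\<close>, and disjointness makes it unique.\<close>

lemma tiling_sum_expand:
  assumes "finite A" and "c \<in> A"
  shows "tiling_sum w A =
    (\<Sum>t | tile_cells t \<subseteq> A \<and> c \<in> tile_cells t. w t * tiling_sum w (A - tile_cells t))"
proof -
  let ?I = "{t. tile_cells t \<subseteq> A \<and> c \<in> tile_cells t}"
  have fin: "finite ?I"
    by (rule finite_subset[OF _ finite_tiles_subset[OF assms(1)]]) auto
  have "tilings A = (\<Union>t\<in>?I. {T \<in> tilings A. t \<in> T})"
    using assms(2) by (fastforce simp: tilings_def)
  then have "tiling_sum w A = (\<Sum>T\<in>(\<Union>t\<in>?I. {T \<in> tilings A. t \<in> T}). \<Prod>t\<in>T. w t)"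
    by (simp add: tiling_sum_def)
  also have "\<dots> = (\<Sum>t\<in>?I. \<Sum>T\<in>{T \<in> tilings A. t \<in> T}. \<Prod>t\<in>T. w t)"
  proof (rule sum.UNION_disjoint[OF fin])
    show "\<forall>t\<in>?I. finite {T \<in> tilings A. t \<in> T}"
      using finite_tilings[OF assms(1)] by simp
    have "s = t" if "s \<in> ?I" "t \<in> ?I" "T \<in> tilings A" "s \<in> T" "t \<in> T" for s t T
      using that unfolding tilings_def disjoint_family_on_def by blast
    then show "\<forall>s\<in>?I. \<forall>t\<in>?I. s \<noteq> t \<longrightarrow> {T \<in> tilings A. s \<in> T} \<inter> {T \<in> tilings A. t \<in> T} = {}"
      by blast
  qed
  also have "\<dots> = (\<Sum>t\<in>?I. w t * tiling_sum w (A - tile_cells t))"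
  proof (rule sum.cong[OF refl])
    fix t assume t: "t \<in> ?I"
    have "(\<Sum>T\<in>{T \<in> tilings A. t \<in> T}. \<Prod>t\<in>T. w t) =
        (\<Sum>T\<in>tilings (A - tile_cells t). \<Prod>t\<in>insert t T. w t)"
      using t by (intro sum.reindex_bij_betw[symmetric] insert_tilings) auto
    also have "\<dots> = (\<Sum>T\<in>tilings (A - tile_cells t). w t * (\<Prod>t\<in>T. w t))"
    proof (rule sum.cong[OF refl])
      fix T assume T: "T \<in> tilings (A - tile_cells t)"
      then have "t \<notin> T"
        using top_right_in_tile_cells[of t] by (auto simp: tilings_def)
      then show "(\<Prod>t\<in>insert t T. w t) = w t * (\<Prod>t\<in>T. w t)"
        using finite_tiling[OF T] assms(1) by simp
    qed
    finally show "(\<Sum>T\<in>{T \<in> tilings A. t \<in> T}. \<Prod>t\<in>T. w t) =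
        w t * tiling_sum w (A - tile_cells t)"
      by (simp add: tiling_sum_def sum_distrib_left)
  qed
  finally show ?thesis .
qed

text \<open>Induction on \<open>A\<close>: expand at a cell of \<open>A\<close>, discard the tiles
  crossing the cut, which have weight 0, and apply the hypothesis to the rest of \<open>A\<close>
  while \<open>B\<close> stays whole.\<close>

lemma tiling_sum_Un:
  assumes "finite A" and "finite B" and "A \<inter> B = {}"
    and "\<And>t. tile_cells t \<subseteq> A \<union> B \<Longrightarrow> w t \<noteq> 0 \<Longrightarrow> tile_cells t \<subseteq> A \<or> tile_cells t \<subseteq> B"
  shows "tiling_sum w (A \<union> B) = tiling_sum w A * tiling_sum w B"
  using assms
proof (induction A rule: finite_psubset_induct)
  case (psubset A)
  show ?case
  proof (cases "A = {}")
    case False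
    then obtain c where c: "c \<in> A" by auto
    let ?I = "\<lambda>A. {t. tile_cells t \<subseteq> A \<and> c \<in> tile_cells t}"
    have "tiling_sum w (A \<union> B) =
        (\<Sum>t\<in>?I (A \<union> B). w t * tiling_sum w (A \<union> B - tile_cells t))"
      using psubset.hyps psubset.prems(1) c by (intro tiling_sum_expand) simp_all
    \<comment> \<open>The covering tile contains \<open>c\<close>, which is not in \<open>B\<close>;
      if it also leaves \<open>A\<close>, it crosses the cut and its term vanishes.\<close>
    also have "\<dots> = (\<Sum>t\<in>?I A. w t * tiling_sum w (A \<union> B - tile_cells t))"
    proof (rule sum.mono_neutral_right)
      show "finite (?I (A \<union> B))"
        by (rule finite_subset[OF _ finite_tiles_subset[of "A \<union> B"]])
          (use psubset.hyps psubset.prems(1) in auto)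
      show "\<forall>t\<in>?I (A \<union> B) - ?I A. w t * tiling_sum w (A \<union> B - tile_cells t) = 0"
      proof
        fix t assume t: "t \<in> ?I (A \<union> B) - ?I A"
        then have "\<not> tile_cells t \<subseteq> B"
          using psubset.prems(2) c by blast
        then have "w t = 0"
          using psubset.prems(3)[of t] t by blast
        then show "w t * tiling_sum w (A \<union> B - tile_cells t) = 0"
          by simp
      qed
    qed auto
    also have "\<dots> = (\<Sum>t\<in>?I A. w t * tiling_sum w (A - tile_cells t)) * tiling_sum w B"
      unfolding sum_distrib_right
    proof (rule sum.cong[OF refl])
      fix t assume t: "t \<in> ?I A"
      then have eq: "A \<union> B - tile_cells t = (A - tile_cells t) \<union> B"
        using psubset.prems by blast
      have "tiling_sum w (A - tile_cells t \<union> B) =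
          tiling_sum w (A - tile_cells t) * tiling_sum w B"
      proof (rule psubset.IH)
        fix s assume "tile_cells s \<subseteq> A - tile_cells t \<union> B" "w s \<noteq> 0"
        then show "tile_cells s \<subseteq> A - tile_cells t \<or> tile_cells s \<subseteq> B"
          using psubset.prems(3)[of s] psubset.prems(2) t by blast
      qed (use psubset.prems t c in blast)+
      then show "w t * tiling_sum w (A \<union> B - tile_cells t) =
          w t * tiling_sum w (A - tile_cells t) * tiling_sum w B"
        by (simp add: eq mult.assoc)
    qed
    also have "\<dots> = tiling_sum w A * tiling_sum w B"
      by (simp only: tiling_sum_expand[OF psubset.hyps(1) c, of w])
    finally show ?thesis .
  qed simp
qed

section \<open>Tilings of a single row or a single column\<close>

lemma tiles_containing:
  assumes "(i, j) \<in> tile_cells t"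
  shows "t \<in> {Monomino (i, j), Horizontal (i, j), Horizontal (i + 1, j),
    Vertical (i, j), Vertical (i, j + 1)}"
  \<comment> \<open>Subtraction truncates at 0: a domino such as \<open>Horizontal (0, j)\<close>
    covers only \<open>(0, j)\<close>, and is then still among the five listed tiles.\<close>
  using assms by (cases t rule: tile_cells.cases) (auto; linarith)+

lemma tiling_sum_row_rec:
  assumes "j > 0"
  shows "tiling_sum w ({1..Suc k} \<times> {j}) =
    w (Monomino (Suc k, j)) * tiling_sum w ({1..k} \<times> {j}) +
    (if k = 0 then 0 else w (Horizontal (Suc k, j)) * tiling_sum w ({1..k - 1} \<times> {j}))"
proof -
  define A where "A = {1..Suc k} \<times> {j}"
  let ?t = "Monomino (Suc k, j)" and ?s = "Horizontal (Suc k, j)"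
  \<comment> \<open>\<open>j > 0\<close> excludes \<open>Vertical (Suc k, 0)\<close>, whose two
    cells collapse into one cell of row 0. For \<open>k = 0\<close> the horizontal domino would need
    the cell \<open>(0, j)\<close>, outside the row.\<close>
  have tiles: "{t. tile_cells t \<subseteq> A \<and> (Suc k, j) \<in> tile_cells t} = (if k = 0 then {?t} else {?t, ?s})"
    using assms by (auto simp: A_def dest!: tiles_containing)
  have cells: "A - tile_cells ?t = {1..k} \<times> {j}" "A - tile_cells ?s = {1..k - 1} \<times> {j}"
    by (auto simp: A_def)
  have "finite A" "(Suc k, j) \<in> A"
    by (auto simp: A_def)
  then have "tiling_sum w A = (\<Sum>t\<in>(if k = 0 then {?t} else {?t, ?s}).
      w t * tiling_sum w (A - tile_cells t))"
    unfolding tiles[symmetric] by (rule tiling_sum_expand)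
  then have "tiling_sum w A = w ?t * tiling_sum w (A - tile_cells ?t) +
      (if k = 0 then 0 else w ?s * tiling_sum w (A - tile_cells ?s))"
    by (simp del: tile_cells.simps split: if_splits)
  then show ?thesis
    unfolding cells unfolding A_def .
qed

text \<open>The row argument with the coordinates exchanged, expanding at the top cell.\<close>

lemma tiling_sum_column_rec:
  assumes "i > 0"
  shows "tiling_sum w ({i} \<times> {1..Suc k}) =
    w (Monomino (i, Suc k)) * tiling_sum w ({i} \<times> {1..k}) +
    (if k = 0 then 0 else w (Vertical (i, Suc k)) * tiling_sum w ({i} \<times> {1..k - 1}))"
proof -
  define A where "A = {i} \<times> {1..Suc k}"
  let ?t = "Monomino (i, Suc k)" and ?s = "Vertical (i, Suc k)"
  have tiles: "{t. tile_cells t \<subseteq> A \<and> (i, Suc k) \<in> tile_cells t} = (if k = 0 then {?t} else {?t, ?s})"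
    using assms by (auto simp: A_def dest!: tiles_containing)
  have cells: "A - tile_cells ?t = {i} \<times> {1..k}" "A - tile_cells ?s = {i} \<times> {1..k - 1}"
    by (auto simp: A_def)
  have "finite A" "(i, Suc k) \<in> A"
    by (auto simp: A_def)
  then have "tiling_sum w A = (\<Sum>t\<in>(if k = 0 then {?t} else {?t, ?s}).
      w t * tiling_sum w (A - tile_cells t))"
    unfolding tiles[symmetric] by (rule tiling_sum_expand)
  then have "tiling_sum w A = w ?t * tiling_sum w (A - tile_cells ?t) +
      (if k = 0 then 0 else w ?s * tiling_sum w (A - tile_cells ?s))"
    by (simp del: tile_cells.simps split: if_splits)
  then show ?thesis
    unfolding cells unfolding A_def .
qed

section \<open>Fibonacci q-integers\<close>

lemma q_int_add: "q_int (a + b) = q_int a + monom 1 a * q_int b"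
proof -
  have "q_int (a + b) = (\<Sum>k<a. monom 1 k) + (\<Sum>k=a..<a+b. monom 1 k)"
    unfolding q_int_def by (simp add: lessThan_atLeast0 sum.atLeastLessThan_concat)
  also have "(\<Sum>k=a..<a+b. monom (1::int) k) = (\<Sum>k<b. monom 1 (a + k))"
    using sum.shift_bounds_nat_ivl[of "monom (1::int)" 0 a b]
    by (simp add: lessThan_atLeast0 add.commute)
  finally show ?thesis
    by (simp add: q_int_def sum_distrib_left mult_monom)
qed

lemma q_int_0 [simp]: "q_int 0 = 0"
  by (simp add: q_int_def)

lemma q_int_eq_0_iff [simp]: "q_int n = 0 \<longleftrightarrow> n = 0"
proof -
  have "coeff (q_int n) 0 = (if n = 0 then 0 else 1)"
    by (simp add: q_int_def coeff_sum sum.delta)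
  then show ?thesis
    by (auto split: if_splits)
qed

lemma q_fib_fact_nonzero: "q_fib_fact n \<noteq> 0"
  by (simp add: q_fib_fact_def fib_neq_0_nat)

lemma q_fib_fact_0 [simp]: "q_fib_fact 0 = 1"
  by (simp add: q_fib_fact_def)

lemma q_fib_fact_Suc: "q_fib_fact (Suc n) = q_fib_fact n * q_int (fib (Suc n))"
  by (simp add: q_fib_fact_def)

text \<open>As a quotient, \<open>S k\<close> is [F_(k+1) a] / [a]; multiplying by
  \<open>q_int a\<close> avoids division. Via \<open>q_int_add\<close> the recurrence mirrors
  F_(k+3) = F_(k+2) + F_(k+1). The bound \<open>N\<close> restricts the premises to cells whose
  weights are known.\<close>

lemma fibonacci_q_recurrence:
  assumes "S 0 = 1" and "N \<ge> 1 \<Longrightarrow> S (Suc 0) = 1"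
    and "\<And>k. k + 2 \<le> N \<Longrightarrow> S (k + 2) = S (k + 1) + monom 1 (fib (k + 2) * a) * S k"
    and "k \<le> N"
  shows "S k * q_int a = q_int (fib (k + 1) * a)"
  using assms(4)
proof (induction k rule: fib.induct)
  case (3 k)
  have "S (Suc (Suc k)) * q_int a =
      S (Suc k) * q_int a + monom 1 (fib (k + 2) * a) * (S k * q_int a)"
    using assms(3)[of k] 3(3) by (simp add: algebra_simps)
  also have "\<dots> = q_int (fib (k + 2) * a) + monom 1 (fib (k + 2) * a) * q_int (fib (k + 1) * a)"
    using 3 by simp
  also have "\<dots> = q_int (fib (Suc (Suc k) + 1) * a)"
    using q_int_add[of "fib (k + 2) * a" "fib (k + 1) * a"] by (simp add: algebra_simps)
  finally show ?case .
qed (use assms in auto)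

section \<open>East steps\<close>

lemma step_neq: "s \<noteq> East \<longleftrightarrow> s = North"
  by (cases s) auto

lemma east_steps_Nil [simp]: "east_steps [] = {}"
  by (simp add: east_steps_def)

text \<open>Earlier endpoints depend only on prefixes of \<open>p\<close>, so they survive the
  extension. This permits induction on the last step.\<close>

lemma east_steps_snoc: "east_steps (p @ [s]) =
  (if s = East then insert (Suc (count_list p East), count_list p North) (east_steps p)
   else east_steps p)"
proof -
  let ?E = "\<lambda>p. {k. k < length p \<and> p ! k = East}"
  let ?f = "\<lambda>p k. (count_list (take (Suc k) p) East, count_list (take (Suc k) p) North)"
  have image: "east_steps p = ?f p ` ?E p" for p
    by (simp add: east_steps_def setcompr_eq_image)
  have "?E (p @ [s]) = ?E p \<union> (if s = East then {length p} else {})"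
    by (auto simp: nth_append less_Suc_eq)
  then have "east_steps (p @ [s]) =
      ?f (p @ [s]) ` ?E p \<union> ?f (p @ [s]) ` (if s = East then {length p} else {})"
    unfolding image by (simp only: image_Un)
  also have "?f (p @ [s]) ` ?E p = east_steps p"
    unfolding image by (intro image_cong) auto
  finally show ?thesis by simp
qed

lemma east_steps_bounds:
  "(i, h) \<in> east_steps p \<Longrightarrow> 1 \<le> i \<and> i \<le> count_list p East \<and> h \<le> count_list p North"
  by (induction p rule: rev_induct) (fastforce simp: east_steps_snoc split: if_splits)+

lemma east_steps_column:
  "1 \<le> i \<Longrightarrow> i \<le> count_list p East \<Longrightarrow> \<exists>h. (i, h) \<in> east_steps p"
  by (induction p rule: rev_induct)
     (auto simp: east_steps_snoc le_Suc_eq split: if_splits)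

section \<open>The tiling sum of a path\<close>

text \<open>The conditions on path-domino tilings that concern one tile at a time, isolated so that
  they can be absorbed into a weight.\<close>

definition admissible :: "step list \<Rightarrow> tile \<Rightarrow> bool" where
  "admissible p t \<longleftrightarrow> (above_path p t \<or> below_path p t) \<and>
    (above_path p t \<longrightarrow> (\<exists>c. t = Monomino c \<or> t = Horizontal c)) \<and>
    (below_path p t \<longrightarrow> (\<exists>c. t = Monomino c \<or> t = Vertical c)) \<and>
    (touches_from_below p t \<longrightarrow> (\<exists>c. t = Vertical c))"

text \<open>Weight 0 on inadmissible tiles lets the sum run over all tilings, as the expansion and
  factorization of \<open>tiling_sum\<close> require.\<close>

definition path_weight :: "step list \<Rightarrow> tile \<Rightarrow> int poly" where
  "path_weight p t = (if admissible p t then tile_weight p t else 0)"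

lemma finite_rectangle [simp]: "finite (rectangle m n)"
  by (simp add: rectangle_def)

lemma path_weight_snoc_North: "path_weight (p @ [North]) = path_weight p"
proof -
  have "east_steps (p @ [North]) = east_steps p"
    by (simp add: east_steps_snoc)
  then have "above_path (p @ [North]) = above_path p" "below_path (p @ [North]) = below_path p"
    "touches_from_below (p @ [North]) = touches_from_below p"
    by (simp_all add: fun_eq_iff above_path_def below_path_def touches_from_below_def)
  moreover from this have "tile_weight (p @ [North]) t = tile_weight p t" for t
    by (cases t rule: tile_cells.cases) simp_all
  ultimately show ?thesis
    by (simp add: fun_eq_iff path_weight_def admissible_def)
qed

text \<open>The new east step lies in a column to the right of every cell of \<open>t\<close>, so no
  condition on \<open>t\<close> sees it.\<close>

lemma path_weight_snoc_East:
  assumes "tile_cells t \<subseteq> rectangle (count_list p East) n"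
  shows "path_weight (p @ [East]) t = path_weight p t"
proof -
  have eq: "(i, h) \<in> east_steps (p @ [East]) \<longleftrightarrow> (i, h) \<in> east_steps p"
    if "(i, j) \<in> tile_cells t" for i j h
    using that assms by (auto simp: east_steps_snoc rectangle_def)
  have above: "above_path (p @ [East]) t = above_path p t"
    unfolding above_path_def using eq by (intro ball_cong refl) blast
  have below: "below_path (p @ [East]) t = below_path p t"
    unfolding below_path_def using eq by (intro ball_cong refl) blast
  have "top_right t \<in> east_steps (p @ [East]) \<longleftrightarrow> top_right t \<in> east_steps p"
    using eq[of "fst (top_right t)" "snd (top_right t)" "snd (top_right t)"]
      top_right_in_tile_cells[of t] by simp
  then have touches: "touches_from_below (p @ [East]) t = touches_from_below p t"
    by (simp add: touches_from_below_def below)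
  then have "tile_weight (p @ [East]) t = tile_weight p t"
    by (cases t rule: tile_cells.cases) simp_all
  then show ?thesis
    by (simp add: path_weight_def admissible_def above below touches)
qed

section \<open>Tiles in the row above a path and in its last column\<close>

lemma path_weight_above:
  assumes "tile_cells t \<subseteq> {1..count_list p East} \<times> {Suc (count_list p North)}"
  shows "path_weight p t = (case t of Vertical c \<Rightarrow> 0 | _ \<Rightarrow> tile_weight p t)"
proof -
  \<comment> \<open>Each column has an east step, and none rises above the final height of
    \<open>p\<close>, which is one less than \<open>j\<close>.\<close>
  have "\<exists>h<j. (i, h) \<in> east_steps p" "\<not> (\<exists>h\<ge>j. (i, h) \<in> east_steps p)"
    if "(i, j) \<in> tile_cells t" for i j
  proof -
    have "1 \<le> i" "i \<le> count_list p East" "j = Suc (count_list p North)"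
      using subsetD[OF assms that] by auto
    then show "\<exists>h<j. (i, h) \<in> east_steps p" "\<not> (\<exists>h\<ge>j. (i, h) \<in> east_steps p)"
      using east_steps_column[of i p] east_steps_bounds[of i _ p]
      by (metis less_Suc_eq_le, metis not_less_eq_eq)
  qed
  then have "above_path p t" "\<not> below_path p t"
    using top_right_in_tile_cells[of t]
    by (fastforce simp: above_path_def below_path_def)+
  then show ?thesis
    by (auto simp: path_weight_def admissible_def touches_from_below_def split: tile.split)
qed

lemma last_column_east_step:
  "(Suc (count_list p East), h) \<in> east_steps (p @ [East]) \<longleftrightarrow> h = count_list p North"
  by (auto simp: east_steps_snoc dest: east_steps_bounds)

text \<open>The only east step of this column runs along its top, so the whole column is below the
  path, and exactly the tile reaching the top touches it.\<close>

lemma path_weight_last_column: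
  assumes "tile_cells t \<subseteq> {Suc (count_list p East)} \<times> {1..count_list p North}"
  shows "path_weight (p @ [East]) t =
    (case t of Monomino (i, j) \<Rightarrow> if j = count_list p North then 0 else 1
     | Horizontal c \<Rightarrow> 0
     | Vertical (i, j) \<Rightarrow>
         if j = count_list p North then monom 1 (fib (i + 1) * fib j)
         else monom 1 (fib i * fib j))"
proof -
  have steps: "(\<exists>h\<ge>j. (i, h) \<in> east_steps (p @ [East])) \<and>
      \<not> (\<exists>h<j. (i, h) \<in> east_steps (p @ [East]))" if "(i, j) \<in> tile_cells t" for i j
  proof -
    have "i = Suc (count_list p East)" "j \<le> count_list p North"
      using subsetD[OF assms that] by auto
    then show ?thesis
      by (simp add: last_column_east_step)
  qed
  have below: "below_path (p @ [East]) t"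
    unfolding below_path_def using steps by blast
  \<comment> \<open>\<open>above_path\<close> quantifies universally over cells, so refuting it
    takes an actual cell of \<open>t\<close>.\<close>
  obtain a b where ab: "top_right t = (a, b)" "(a, b) \<in> tile_cells t"
    using top_right_in_tile_cells[of t] by (cases "top_right t") auto
  have above: "\<not> above_path (p @ [East]) t"
    unfolding above_path_def using steps[OF ab(2)] ab(2) by blast
  have "a = Suc (count_list p East)"
    using subsetD[OF assms ab(2)] by simp
  then have "touches_from_below (p @ [East]) t \<longleftrightarrow> b = count_list p North"
    by (simp add: touches_from_below_def below ab(1) last_column_east_step)
  then show ?thesis
    using below above ab(1)
    by (cases t rule: tile_cells.cases) (simp_all add: path_weight_def admissible_def)
qed

text \<open>Monominos weigh 1 and the horizontal domino ending in column k weighs q^(F_k F_(n+1)),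
  so the Fibonacci recurrence applies with \<open>a = fib (Suc n)\<close>.\<close>

lemma row_sum:
  assumes "count_list p East = m" and "count_list p North = n"
  shows "tiling_sum (path_weight p) ({1..m} \<times> {Suc n}) * q_int (fib (Suc n)) =
    q_int (fib (m + 1) * fib (Suc n))"
proof (rule fibonacci_q_recurrence[where N = m and S = "\<lambda>k. tiling_sum (path_weight p) ({1..k} \<times> {Suc n})"])
  show "tiling_sum (path_weight p) ({1..Suc 0} \<times> {Suc n}) = 1" if "m \<ge> 1"
    using that assms path_weight_above[of "Monomino (1, Suc n)" p]
    by (subst tiling_sum_row_rec) simp_all
next
  fix k assume k: "k + 2 \<le> m"
  show "tiling_sum (path_weight p) ({1..k + 2} \<times> {Suc n}) =
      tiling_sum (path_weight p) ({1..k + 1} \<times> {Suc n}) +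
      monom 1 (fib (k + 2) * fib (Suc n)) * tiling_sum (path_weight p) ({1..k} \<times> {Suc n})"
    using k assms path_weight_above[of "Monomino (k + 2, Suc n)" p]
      path_weight_above[of "Horizontal (k + 2, Suc n)" p]
    using tiling_sum_row_rec[of "Suc n" "path_weight p" "Suc k"] by simp
qed auto

text \<open>The top tile must be a special vertical domino, which yields the power of q; the cells
  under it obey the Fibonacci recurrence with \<open>a = fib (Suc m)\<close>.\<close>

lemma column_sum:
  assumes "count_list p East = m" and "count_list p North = Suc n"
  shows "tiling_sum (path_weight (p @ [East])) ({Suc m} \<times> {1..Suc n}) * q_int (fib (Suc m)) =
    monom 1 (fib (m + 2) * fib (Suc n)) * q_int (fib n * fib (Suc m))"
proof -
  let ?w = "path_weight (p @ [East])"
  have mono: "?w (Monomino (Suc m, j)) = (if j = Suc n then 0 else 1)"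
    if "1 \<le> j" "j \<le> Suc n" for j
    using that assms path_weight_last_column[of "Monomino (Suc m, j)" p] by simp
  have vert: "?w (Vertical (Suc m, j)) = (if j = Suc n then monom 1 (fib (m + 2) * fib j)
      else monom 1 (fib (m + 1) * fib j))"
    if "2 \<le> j" "j \<le> Suc n" for j
  proof -
    have "tile_cells (Vertical (Suc m, j)) \<subseteq> {Suc (count_list p East)} \<times> {1..count_list p North}"
      using that assms by auto
    then show ?thesis
      using assms path_weight_last_column[of "Vertical (Suc m, j)" p] by simp
  qed
  show ?thesis
  \<comment> \<open>In a column of height 1 the special domino does not fit; both sides are 0, the
    right one because \<open>fib 0 = 0\<close>.\<close>
  proof (cases n)
    case 0
    then show ?thesis
      using tiling_sum_column_rec[of "Suc m" ?w 0] mono[of 1] by simp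
  next
    case (Suc l)
    have "tiling_sum ?w ({Suc m} \<times> {1..l}) * q_int (fib (Suc m)) =
        q_int (fib (l + 1) * fib (Suc m))"
    \<comment> \<open>The special domino takes two of the \<open>Suc n\<close> cells, leaving height
      \<open>l = n - 1\<close>, where all weights are the ordinary ones.\<close>
    proof (rule fibonacci_q_recurrence[where N = l and S = "\<lambda>k. tiling_sum ?w ({Suc m} \<times> {1..k})"])
      show "tiling_sum ?w ({Suc m} \<times> {1..Suc 0}) = 1" if "l \<ge> 1"
        using that Suc mono[of 1] by (subst tiling_sum_column_rec) simp_all
    next
      fix k assume k: "k + 2 \<le> l"
      show "tiling_sum ?w ({Suc m} \<times> {1..k + 2}) = tiling_sum ?w ({Suc m} \<times> {1..k + 1}) +
          monom 1 (fib (k + 2) * fib (Suc m)) * tiling_sum ?w ({Suc m} \<times> {1..k})"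
        using k Suc mono[of "k + 2"] vert[of "k + 2"]
          tiling_sum_column_rec[of "Suc m" ?w "Suc k"] by (simp add: mult.commute)
    qed auto
    moreover have "tiling_sum ?w ({Suc m} \<times> {1..Suc n}) =
        monom 1 (fib (m + 2) * fib (Suc n)) * tiling_sum ?w ({Suc m} \<times> {1..l})"
      using Suc mono[of "Suc n"] vert[of "Suc n"] tiling_sum_column_rec[of "Suc m" ?w n] by simp
    ultimately show ?thesis
      using Suc by (simp add: mult.assoc)
  qed
qed

lemma tiling_sum_snoc_North:
  assumes "count_list p East = m" and "count_list p North = n"
  shows "tiling_sum (path_weight (p @ [North])) (rectangle m (Suc n)) =
    tiling_sum (path_weight p) (rectangle m n) * tiling_sum (path_weight p) ({1..m} \<times> {Suc n})"
proof -
  have rect: "rectangle m (Suc n) = rectangle m n \<union> {1..m} \<times> {Suc n}"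
    by (auto simp: rectangle_def)
  show ?thesis
    unfolding path_weight_snoc_North rect
  proof (rule tiling_sum_Un)
    fix t
    assume t: "tile_cells t \<subseteq> rectangle m n \<union> {1..m} \<times> {Suc n}" and w: "path_weight p t \<noteq> 0"
    show "tile_cells t \<subseteq> rectangle m n \<or> tile_cells t \<subseteq> {1..m} \<times> {Suc n}"
    proof (cases t rule: tile_cells.cases)
      case (3 i j)
      \<comment> \<open>Only a vertical domino could cross into the top row, but its upper cell
        would lie above every east step, so it would not be below the path.\<close>
      have "j \<noteq> Suc n"
      proof
        assume "j = Suc n"
        then have "\<not> below_path p t"
          using 3 assms east_steps_bounds[of i _ p] by (fastforce simp: below_path_def)
        then show False
          using w 3 by (auto simp: path_weight_def admissible_def split: if_splits)
      qed
      then show ?thesis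
        using t 3 by (auto simp: rectangle_def)
    qed (use t in \<open>auto simp: rectangle_def\<close>)
  qed (auto simp: rectangle_def)
qed

lemma tiling_sum_snoc_East:
  assumes "count_list p East = m" and "count_list p North = n"
  shows "tiling_sum (path_weight (p @ [East])) (rectangle (Suc m) n) =
    tiling_sum (path_weight p) (rectangle m n) *
    tiling_sum (path_weight (p @ [East])) ({Suc m} \<times> {1..n})"
proof -
  let ?w = "path_weight (p @ [East])"
  have rect: "rectangle (Suc m) n = rectangle m n \<union> {Suc m} \<times> {1..n}"
    by (auto simp: rectangle_def)
  have "tiling_sum ?w (rectangle m n \<union> {Suc m} \<times> {1..n}) =
      tiling_sum ?w (rectangle m n) * tiling_sum ?w ({Suc m} \<times> {1..n})"
  proof (rule tiling_sum_Un)
    fix t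
    assume t: "tile_cells t \<subseteq> rectangle m n \<union> {Suc m} \<times> {1..n}" and w: "?w t \<noteq> 0"
    show "tile_cells t \<subseteq> rectangle m n \<or> tile_cells t \<subseteq> {Suc m} \<times> {1..n}"
    proof (cases t rule: tile_cells.cases)
      case (2 i j)
      \<comment> \<open>Only a horizontal domino could cross into the last column, but its right
        cell would lie under the final east step, so it would not be above the path.\<close>
      have "i \<noteq> Suc m"
      proof
        assume "i = Suc m"
        moreover have "j \<le> n"
          using t 2 by (auto simp: rectangle_def)
        ultimately have "\<not> above_path (p @ [East]) t"
          using 2 assms last_column_east_step[of p] by (auto simp: above_path_def)
        then show False
          using w 2 by (auto simp: path_weight_def admissible_def split: if_splits)
      qed
      then show ?thesis
        using t 2 by (auto simp: rectangle_def)
    qed (use t in \<open>auto simp: rectangle_def\<close>)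
  qed (auto simp: rectangle_def)
  moreover have "tiling_sum ?w (rectangle m n) = tiling_sum (path_weight p) (rectangle m n)"
    using assms by (intro tiling_sum_cong path_weight_snoc_East) auto
  ultimately show ?thesis
    by (simp add: rect)
qed

section \<open>The recurrence\<close>

text \<open>The sum of the theorem with the tile conditions moved into the weights, a form suited to
  recursion on the last step.\<close>

definition path_sum :: "nat \<Rightarrow> nat \<Rightarrow> int poly" where
  "path_sum m n = (\<Sum>p\<in>lattice_paths m n. tiling_sum (path_weight p) (rectangle m n))"

section \<open>Lattice paths and their last step\<close>

lemma length_eq_count_steps: "length p = count_list p East + count_list p North"
  by (induction p) (auto simp: step_neq)

lemma finite_lattice_paths [simp]: "finite (lattice_paths m n)"
proof (rule finite_subset)
  have "set p \<subseteq> {North, East}" for p :: "step list"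
    using step.exhaust by blast
  then show "lattice_paths m n \<subseteq> {p. set p \<subseteq> {North, East} \<and> length p = m + n}"
    by (auto simp: lattice_paths_def length_eq_count_steps)
qed (rule finite_lists_length_eq, simp)

lemma lattice_paths_0: "lattice_paths m 0 = {replicate m East}" "lattice_paths 0 n = {replicate n North}"
proof -
  have "p = replicate m East" if "count_list p East = m" "count_list p North = 0" for p
    using that by (induction p arbitrary: m) (auto simp: step_neq split: if_splits)
  moreover have "p = replicate n North" if "count_list p East = 0" "count_list p North = n" for p
    using that by (induction p arbitrary: n) (auto simp: step_neq split: if_splits)
  moreover have "count_list (replicate k s) t = (if s = t then k else 0)" for k and s t :: step
    by (induction k) auto
  ultimately show "lattice_paths m 0 = {replicate m East}"
      "lattice_paths 0 n = {replicate n North}"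
    by (auto simp: lattice_paths_def)
qed

lemma lattice_paths_Suc_Suc: "lattice_paths (Suc m) (Suc n) =
  (\<lambda>p. p @ [North]) ` lattice_paths (Suc m) n \<union> (\<lambda>p. p @ [East]) ` lattice_paths m (Suc n)"
  (is "?L = ?R")
proof
  show "?L \<subseteq> ?R"
  proof
    fix p assume "p \<in> ?L"
    then show "p \<in> ?R"
      by (cases p rule: rev_cases)
         (auto simp: lattice_paths_def step_neq split: if_splits)
  qed
qed (auto simp: lattice_paths_def)

lemma path_sum_0: "path_sum m 0 = 1" "path_sum 0 n = 1"
  by (simp_all add: path_sum_def lattice_paths_0 rectangle_def)

lemma path_sum_Suc_Suc: "path_sum (Suc m) (Suc n) =
  (\<Sum>p\<in>lattice_paths (Suc m) n. tiling_sum (path_weight p) (rectangle (Suc m) n) *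
      tiling_sum (path_weight p) ({1..Suc m} \<times> {Suc n})) +
  (\<Sum>p\<in>lattice_paths m (Suc n). tiling_sum (path_weight p) (rectangle m (Suc n)) *
      tiling_sum (path_weight (p @ [East])) ({Suc m} \<times> {1..Suc n}))"
proof -
  have "path_sum (Suc m) (Suc n) =
    (\<Sum>p\<in>lattice_paths (Suc m) n. tiling_sum (path_weight (p @ [North])) (rectangle (Suc m) (Suc n))) +
    (\<Sum>p\<in>lattice_paths m (Suc n). tiling_sum (path_weight (p @ [East])) (rectangle (Suc m) (Suc n)))"
    unfolding path_sum_def lattice_paths_Suc_Suc
    by (subst sum.union_disjoint) (auto simp: sum.reindex inj_on_def)
  also have "(\<Sum>p\<in>lattice_paths (Suc m) n. tiling_sum (path_weight (p @ [North])) (rectangle (Suc m) (Suc n))) =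
    (\<Sum>p\<in>lattice_paths (Suc m) n. tiling_sum (path_weight p) (rectangle (Suc m) n) *
      tiling_sum (path_weight p) ({1..Suc m} \<times> {Suc n}))"
    by (intro sum.cong refl tiling_sum_snoc_North) (auto simp: lattice_paths_def)
  also have "(\<Sum>p\<in>lattice_paths m (Suc n). tiling_sum (path_weight (p @ [East])) (rectangle (Suc m) (Suc n))) =
    (\<Sum>p\<in>lattice_paths m (Suc n). tiling_sum (path_weight p) (rectangle m (Suc n)) *
      tiling_sum (path_weight (p @ [East])) ({Suc m} \<times> {1..Suc n}))"
    by (intro sum.cong refl tiling_sum_snoc_East) (auto simp: lattice_paths_def)
  finally show ?thesis .
qed

text \<open>By \<open>row_sum\<close> and \<open>column_sum\<close> the factor split off by the last
  step depends only on the endpoint of the path, so it leaves the sum over paths. The q-integers on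
  the left clear the denominators.\<close>

lemma path_sum_recurrence:
  "path_sum (Suc m) (Suc n) * (q_int (fib (Suc m)) * q_int (fib (Suc n))) =
    path_sum (Suc m) n * q_int (fib (Suc m)) * q_int (fib (m + 2) * fib (Suc n)) +
    path_sum m (Suc n) * q_int (fib (Suc n)) *
      (monom 1 (fib (m + 2) * fib (Suc n)) * q_int (fib n * fib (Suc m)))"
proof -
  have "(\<Sum>p\<in>lattice_paths (Suc m) n. tiling_sum (path_weight p) (rectangle (Suc m) n) *
      tiling_sum (path_weight p) ({1..Suc m} \<times> {Suc n})) * q_int (fib (Suc n)) =
    path_sum (Suc m) n * q_int (fib (m + 2) * fib (Suc n))"
    unfolding path_sum_def sum_distrib_right mult.assoc
    using row_sum[of _ "Suc m" n] by (intro sum.cong refl) (auto simp: lattice_paths_def)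
  moreover have "(\<Sum>p\<in>lattice_paths m (Suc n). tiling_sum (path_weight p) (rectangle m (Suc n)) *
      tiling_sum (path_weight (p @ [East])) ({Suc m} \<times> {1..Suc n})) * q_int (fib (Suc m)) =
    path_sum m (Suc n) * (monom 1 (fib (m + 2) * fib (Suc n)) * q_int (fib n * fib (Suc m)))"
    unfolding path_sum_def sum_distrib_right mult.assoc
    using column_sum[of _ m n] by (intro sum.cong refl) (auto simp: lattice_paths_def mult.assoc)
  ultimately show ?thesis
    unfolding path_sum_Suc_Suc by algebra
qed

lemma path_sum_fact: "path_sum m n * (q_fib_fact m * q_fib_fact n) = q_fib_fact (m + n)"
proof (induction "m + n" arbitrary: m n)
  case 0
  then show ?case by (simp add: path_sum_0)
next
  case (Suc N)
  show ?case
  proof (cases "m = 0 \<or> n = 0")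
    case True
    then show ?thesis by (auto simp: path_sum_0)
  next
    case False
    then obtain a b where ab: "m = Suc a" "n = Suc b"
      by (meson not0_implies_Suc)
    let ?x = "q_int (fib (a + 2) * fib (Suc b))"
    let ?y = "monom 1 (fib (a + 2) * fib (Suc b)) * q_int (fib b * fib (Suc a))"
    have IH: "path_sum (Suc a) b * (q_fib_fact (Suc a) * q_fib_fact b) = q_fib_fact (Suc (a + b))"
      "path_sum a (Suc b) * (q_fib_fact a * q_fib_fact (Suc b)) = q_fib_fact (Suc (a + b))"
      using Suc.hyps(1)[of "Suc a" b] Suc.hyps(1)[of a "Suc b"] Suc.hyps(2) ab by simp_all
    have "path_sum m n * (q_fib_fact m * q_fib_fact n) =
        path_sum (Suc a) (Suc b) * (q_int (fib (Suc a)) * q_int (fib (Suc b))) *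
          (q_fib_fact a * q_fib_fact b)"
      by (simp add: ab q_fib_fact_Suc algebra_simps)
    also have "\<dots> = path_sum (Suc a) b * (q_fib_fact (Suc a) * q_fib_fact b) * ?x +
        path_sum a (Suc b) * (q_fib_fact a * q_fib_fact (Suc b)) * ?y"
      unfolding path_sum_recurrence q_fib_fact_Suc by algebra
    also have "\<dots> = q_fib_fact (Suc (a + b)) * (?x + ?y)"
      unfolding IH by (simp add: algebra_simps)
    \<comment> \<open>The power of q from the special domino has exponent exactly the length of
      \<open>?x\<close>, so the two q-integers concatenate.\<close>
    also have "?x + ?y = q_int (fib (a + 2) * fib (Suc b) + fib b * fib (Suc a))"
      by (simp add: q_int_add)
    also have "fib (a + 2) * fib (Suc b) + fib b * fib (Suc a) = fib (Suc (Suc (a + b)))"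
      using fib_add[of b "Suc a"] by (simp add: algebra_simps)
    finally show ?thesis
      by (simp add: ab q_fib_fact_Suc)
  qed
qed

section \<open>Path-domino tilings\<close>

text \<open>The dependent-sum form allows the sum over pairs to be taken first over paths, then over
  tilings.\<close>

lemma path_domino_tilings_eq: "path_domino_tilings m n =
  (SIGMA p:lattice_paths m n. {T \<in> tilings (rectangle m n). \<forall>t\<in>T. admissible p t})"
  by (auto simp: path_domino_tilings_def tilings_def is_tiling_def admissible_def)

lemma sum_path_domino_tilings:
  "(\<Sum>T\<in>path_domino_tilings m n. tiling_weight T) = path_sum m n"
proof -
  let ?Q = "\<lambda>p. {T \<in> tilings (rectangle m n). \<forall>t\<in>T. admissible p t}"
  have fin: "finite (?Q p)" for p
    using finite_tilings[OF finite_rectangle] by simp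
  have "(\<Sum>T\<in>path_domino_tilings m n. tiling_weight T) =
      (\<Sum>p\<in>lattice_paths m n. \<Sum>T\<in>?Q p. \<Prod>t\<in>T. tile_weight p t)"
    unfolding path_domino_tilings_eq tiling_weight_def
    using fin by (subst sum.Sigma) auto
  also have "\<dots> = path_sum m n"
    unfolding path_sum_def tiling_sum_def
  proof (rule sum.cong[OF refl])
    fix p
    \<comment> \<open>A tiling outside \<open>?Q p\<close> has an inadmissible tile, hence a zero
      factor in its product.\<close>
    have "(\<Sum>T\<in>tilings (rectangle m n). prod (path_weight p) T) =
        (\<Sum>T\<in>?Q p. prod (path_weight p) T)"
    proof (rule sum.mono_neutral_right[OF finite_tilings[OF finite_rectangle]])
      show "\<forall>T\<in>tilings (rectangle m n) - ?Q p. prod (path_weight p) T = 0"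
      proof
        fix T assume T: "T \<in> tilings (rectangle m n) - ?Q p"
        then have "finite T"
          using finite_tiling finite_rectangle by blast
        moreover have "\<exists>t\<in>T. path_weight p t = 0"
          using T by (auto simp: path_weight_def)
        ultimately show "prod (path_weight p) T = 0"
          by (rule prod_zero)
      qed
    qed auto
    also have "\<dots> = (\<Sum>T\<in>?Q p. prod (tile_weight p) T)"
      by (intro sum.cong prod.cong refl) (auto simp: path_weight_def)
    finally show "(\<Sum>T\<in>?Q p. prod (tile_weight p) T) =
        (\<Sum>T\<in>tilings (rectangle m n). prod (path_weight p) T)" ..
  qed
  finally show ?thesis .
qed

lemma tiling_weight_nonneg: "coeff (tiling_weight T) k \<ge> 0"
proof -
  obtain p S where T: "T = (p, S)" by (cases T)
  have "coeff (tile_weight p t) k \<ge> 0" for t k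
    by (cases t rule: tile_cells.cases) simp_all
  then have "coeff (prod (tile_weight p) S) k \<ge> 0"
    \<comment> \<open>\<open>S\<close> is arbitrary here; for an infinite set the product is 1 by
      convention.\<close>
    by (induction S arbitrary: k rule: infinite_finite_induct)
       (auto simp: coeff_mult intro!: sum_nonneg)
  then show ?thesis
    by (simp add: T tiling_weight_def)
qed

theorem theorem2p4:
  fixes m n :: nat
  assumes "m \<ge> 1" and "n \<ge> 1"
  shows "(\<exists>P :: int poly. (\<forall>k. coeff P k \<ge> 0) \<and> q_fibonomial (m + n) n = to_fract P) \<and>
    q_fibonomial (m + n) n = to_fract (\<Sum>T\<in>path_domino_tilings m n. tiling_weight T)"
proof -
  let ?P = "\<Sum>T\<in>path_domino_tilings m n. tiling_weight T"
  \<comment> \<open>The division-free identity is carried into the fraction field, where the nonzero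
    factorials can be divided out; \<open>?P\<close> serves both claims.\<close>
  have "to_fract ?P * (to_fract (q_fib_fact m) * to_fract (q_fib_fact n)) =
      to_fract (q_fib_fact (m + n))"
    by (simp add: sum_path_domino_tilings path_sum_fact flip: to_fract_mult)
  then have "q_fibonomial (m + n) n = to_fract ?P"
    by (simp add: q_fibonomial_def q_fib_fact_nonzero nonzero_divide_eq_eq)
  moreover have "\<forall>k. coeff ?P k \<ge> 0"
    by (simp add: coeff_sum sum_nonneg tiling_weight_nonneg)
  ultimately show ?thesis by blast
qed

end
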